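(* Let $\mathbb{X},\mathbb{Y}$ be Euclidean spaces, $\Phi:\mathbb{X}\to\mathbb{Y}$ a linear operator, $f:\mathbb{Y}\to\mathbb{R}\cup\{\infty\}$ a proper lower semicontinuous convex function that is twice continuously differentiable on $\operatorname{int}(\operatorname{dom} f)$ with $\nabla^2 f(y)$ positive definite for all $y\in\operatorname{int}(\operatorname{dom} f)$, and $g:\mathbb{X}\to\mathbb{R}\cup\{\infty\}$ a proper lower semicontinuous convex function. Let $\bar x\in\Phi^{-1}(\operatorname{int}(\operatorname{dom} f))\cap\operatorname{dom} g$ be an optimal solution of the problem $$\min_{x\in\mathbb{X}}\ f(\Phi x)+g(x),$$ and let $\bar y:=-\Phi^*\nabla f(\Phi\bar x)\in\partial g(\bar x)$. Then $\bar x$ is the unique optimal solution of this problem if and only if $$\operatorname{Ker}\Phi\cap\mathcal{R}_{\partial g^*(\bar y)}(\bar x)=\{0\}.$$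
   Context: $\Phi^*$ is the adjoint of $\Phi$; $\partial$ denotes the convex subdifferential; $g^*$ is the Legendre-Fenchel conjugate of $g$, so that $\partial g^*(\bar y)=(\partial g)^{-1}(\bar y)=\{x\in\mathbb{X}\mid \bar y\in\partial g(x)\}$. For a closed convex set $\Omega\subset\mathbb{X}$ and $\bar x\in\Omega$, the radial cone is $\mathcal{R}_\Omega(\bar x)=\operatorname{cone}(\Omega-\bar x)=\mathbb{R}_+(\Omega-\bar x)=\{t(x-\bar x)\mid t\ge 0,\ x\in\Omega\}$ (not closed in general). *)

theory Defs
  imports "HOL-Analysis.Analysis"
begin

text \<open>
  A function into \<open>\<real> \<union> {\<infinity>}\<close> is an \<^typ>\<open>ereal\<close>-valued function; the exclusion of the
  value \<open>-\<infinity>\<close> is part of \<open>proper\<close>.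
\<close>

definition edom :: "('a \<Rightarrow> ereal) \<Rightarrow> 'a set" where
  "edom h = {x. h x < \<infinity>}"

definition proper :: "('a \<Rightarrow> ereal) \<Rightarrow> bool" where
  "proper h \<longleftrightarrow> (\<forall>x. h x \<noteq> -\<infinity>) \<and> edom h \<noteq> {}"

definition lsc :: "('a::topological_space \<Rightarrow> ereal) \<Rightarrow> bool" where
  "lsc h \<longleftrightarrow> (\<forall>x. h x \<le> Liminf (at x) h)"

text \<open>Convexity as convexity of the epigraph, which avoids any convention for \<open>\<infinity> - \<infinity>\<close>.\<close>

definition econvex :: "('a::real_vector \<Rightarrow> ereal) \<Rightarrow> bool" where
  "econvex h \<longleftrightarrow> convex {(x, r::real). h x \<le> ereal r}"

text \<open>The subdifferential is empty at points where \<open>h\<close> is not finite.\<close>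

definition subdifferential :: "('a::real_inner \<Rightarrow> ereal) \<Rightarrow> 'a \<Rightarrow> 'a set" where
  "subdifferential h x =
     {v. \<bar>h x\<bar> \<noteq> \<infinity> \<and> (\<forall>z. h x + ereal (v \<bullet> (z - x)) \<le> h z)}"

definition conjugate :: "('a::real_inner \<Rightarrow> ereal) \<Rightarrow> 'a \<Rightarrow> ereal" where
  "conjugate h y = (SUP x. ereal (y \<bullet> x) - h x)"

definition radial_cone :: "'a::real_vector set \<Rightarrow> 'a \<Rightarrow> 'a set" where
  "radial_cone \<Omega> x = {t *\<^sub>R (w - x) | t w. 0 \<le> t \<and> w \<in> \<Omega>}"

definition gradient :: "('a::real_inner \<Rightarrow> real) \<Rightarrow> 'a \<Rightarrow> 'a" where
  "gradient F x = (THE d. GDERIV F x :> d)"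

definition hessian :: "('a::real_inner \<Rightarrow> real) \<Rightarrow> 'a \<Rightarrow> 'a \<Rightarrow> 'a" where
  "hessian F x = frechet_derivative (gradient F) (at x)"

text \<open>
  Meant for open \<open>S\<close>. Continuity of the second derivative is with respect to the operator norm;
  continuity of the first derivative follows from the differentiability of the gradient.
\<close>

definition C2_on :: "('a::euclidean_space \<Rightarrow> real) \<Rightarrow> 'a set \<Rightarrow> bool" where
  "C2_on F S \<longleftrightarrow>
     (\<forall>x\<in>S. F differentiable (at x)) \<and>
     (\<forall>x\<in>S. gradient F differentiable (at x)) \<and>
     continuous_on S (\<lambda>x. Blinfun (hessian F x))"

definition positive_definite :: "('a::real_inner \<Rightarrow> 'a) \<Rightarrow> bool" where
  "positive_definite A \<longleftrightarrow> (\<forall>v. v \<noteq> 0 \<longrightarrow> 0 < v \<bullet> A v)"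

definition optimal_solutions :: "('a \<Rightarrow> ereal) \<Rightarrow> 'a set" where
  "optimal_solutions h = {x. is_arg_min h (\<lambda>_. True) x}"

end

theory Submission
  imports Defs
begin

text \<open>
  Write \<open>F\<close> for the real-valued function \<open>f\<close> on the interior of its domain.  Restricting the
  objective to segments through \<open>xbar\<close> gives the first-order condition
  \<open>ybar \<in> \<partial>g(xbar)\<close>; it holds in the same form at every minimizer that \<open>\<Phi>\<close> maps into the interior
  of the domain of \<open>f\<close>.

  Positive definiteness of the Hessian makes the gradient inequality of \<open>f\<close> strict at \<open>\<Phi> xbar\<close>.
  If \<open>x\<close> is a second minimizer, adding this strict inequality to the subgradient inequality of \<open>g\<close>
  at \<open>xbar\<close> contradicts optimality unless \<open>\<Phi> x = \<Phi> xbar\<close>.  All minimizers therefore share one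
  image, hence one gradient, hence the same \<open>ybar\<close> in their first-order conditions.  Conversely, if
  \<open>\<Phi> x = \<Phi> xbar\<close> and \<open>ybar \<in> \<partial>g(x)\<close>, then \<open>ybar\<close>, which lies in the range of the adjoint of \<open>\<Phi>\<close>,
  is orthogonal to \<open>xbar - x\<close>, so \<open>g(x) \<le> g(xbar)\<close> and \<open>x\<close> is a minimizer.

  The set of minimizers is thus the set of points \<open>x\<close> with \<open>x - xbar\<close> in the kernel of \<open>\<Phi>\<close> and
  \<open>ybar \<in> \<partial>g(x)\<close>.  The last condition is \<open>x \<in> \<partial>g\<^sup>*(ybar)\<close> by conjugate duality,
  whose nontrivial direction separates a point from the closed convex epigraph of \<open>g\<close>.  Passing from
  this set to the cone it spans does not change whether its intersection with a subspace is trivial.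
\<close>

section \<open>Convex functions with values in the extended reals\<close>

lemma proper_cases:
  assumes "proper h"
  obtains "h x = \<infinity>" | r where "h x = ereal r"
  using assms by (cases "h x") (auto simp: proper_def)

lemma ereal_real_of_edom:
  assumes "proper h" and "x \<in> edom h"
  shows "h x = ereal (real_of_ereal (h x))"
  using assms by (cases "h x") (auto simp: proper_def edom_def)

lemma econvex_segment:
  assumes "econvex h" and "h x = ereal a" and "h y = ereal b" and "0 \<le> t" and "t \<le> 1"
  shows "h (x + t *\<^sub>R (y - x)) \<le> ereal (a + t * (b - a))"
proof -
  have "convex {(x, r::real). h x \<le> ereal r}"
    using assms(1) by (simp add: econvex_def)
  then have "(1 - t) *\<^sub>R (x, a) + t *\<^sub>R (y, b) \<in> {(x, r::real). h x \<le> ereal r}"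
    by (rule convexD) (use assms in auto)
  moreover have "(1 - t) *\<^sub>R (x, a) + t *\<^sub>R (y, b) = (x + t *\<^sub>R (y - x), a + t * (b - a))"
    by (simp add: algebra_simps)
  ultimately show ?thesis by simp
qed

lemma closed_epigraph:
  fixes h :: "'a::metric_space \<Rightarrow> ereal"
  assumes "lsc h"
  shows "closed {(x, r::real). h x \<le> ereal r}"
  unfolding closed_sequential_limits
proof (intro allI impI, elim conjE)
  fix s :: "nat \<Rightarrow> 'a \<times> real" and l
  assume mem: "\<forall>n. s n \<in> {(x, r). h x \<le> ereal r}" and lim: "s \<longlonglongrightarrow> l"
  obtain x r where l: "l = (x, r)" by (cases l)
  have limx: "(\<lambda>n. fst (s n)) \<longlonglongrightarrow> x" and limr: "(\<lambda>n. snd (s n)) \<longlonglongrightarrow> r"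
    using tendsto_fst[OF lim] tendsto_snd[OF lim] by (simp_all add: l)
  have "h x \<le> ereal r"
  proof (rule ccontr)
    assume "\<not> h x \<le> ereal r"
    then have "ereal r < h x" by simp
    then obtain c where c: "ereal r < ereal c" "ereal c < h x"
      using ereal_dense2 by blast
    have "ereal c < Liminf (at x) h"
      using c assms by (auto simp: lsc_def intro: less_le_trans)
    then have "eventually (\<lambda>y. ereal c < h y) (at x)"
      using less_LiminfD by blast
    then have "eventually (\<lambda>y. ereal c < h y) (nhds x)"
      using c by (auto simp: eventually_at_filter elim: eventually_mono)
    then have "eventually (\<lambda>n. ereal c < h (fst (s n))) sequentially"
      using limx unfolding filterlim_iff by blast
    then have "eventually (\<lambda>n. c \<le> snd (s n)) sequentially"
    proof eventually_elim
      case (elim n)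
      have "h (fst (s n)) \<le> ereal (snd (s n))"
        using mem by (auto simp: split_beta)
      with elim have "ereal c < ereal (snd (s n))" by (rule less_le_trans)
      then show ?case by simp
    qed
    then have "c \<le> r"
      using limr tendsto_lowerbound trivial_limit_sequentially by blast
    then show False using c by simp
  qed
  then show "l \<in> {(x, r). h x \<le> ereal r}" by (simp add: l)
qed

section \<open>Subdifferentials of a function and of its conjugate\<close>

lemma subdifferential_imp_conjugate:
  assumes "y \<in> subdifferential h x"
  shows "x \<in> subdifferential (conjugate h) y"
proof -
  obtain a where a: "h x = ereal a"
    using assms by (cases "h x") (auto simp: subdifferential_def)
  have sub: "ereal (a + y \<bullet> (z - x)) \<le> h z" for z
    using assms a by (auto simp: subdifferential_def)
  have "ereal (y \<bullet> z) - h z \<le> ereal (y \<bullet> x - a)" for z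
    using sub[of z] by (cases "h z") (auto simp: inner_diff_right)
  then have "conjugate h y \<le> ereal (y \<bullet> x - a)"
    unfolding conjugate_def by (rule SUP_least)
  moreover have lower: "ereal (z \<bullet> x - a) \<le> conjugate h z" for z
    unfolding conjugate_def by (rule SUP_upper2[of x]) (auto simp: a)
  ultimately have conj: "conjugate h y = ereal (y \<bullet> x - a)"
    by (simp add: antisym)
  have "conjugate h y + ereal (x \<bullet> (z - y)) \<le> conjugate h z" for z
    using lower[of z] by (simp add: conj algebra_simps inner_commute)
  then show ?thesis
    by (simp add: subdifferential_def conj)
qed

text \<open>
  The inequality to be shown is that the point \<open>(x, \<langle>x, y\<rangle> - h\<^sup>*(y))\<close> belongs to the epigraph of
  \<open>h\<close>.  Otherwise a hyperplane separates it strictly from the epigraph.  A non-vertical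
  hyperplane has a slope \<open>z\<close> at which \<open>h\<^sup>*\<close> violates the subgradient inequality, and for a vertical
  one with normal \<open>p\<close> the point \<open>z = y - p\<close> violates it.
\<close>

lemma conjugate_subdifferential_imp:
  fixes h :: "'a::euclidean_space \<Rightarrow> ereal"
  assumes "proper h" and "lsc h" and "econvex h"
    and sub: "x \<in> subdifferential (conjugate h) y"
  shows "y \<in> subdifferential h x"
proof -
  obtain b where b: "conjugate h y = ereal b"
    using sub by (cases "conjugate h y") (auto simp: subdifferential_def)
  have low: "ereal (b + x \<bullet> (z - y)) \<le> conjugate h z" for z
    using sub b by (auto simp: subdifferential_def)
  have upp: "ereal (y \<bullet> z) - h z \<le> ereal b" for z
    unfolding b[symmetric] conjugate_def by (rule SUP_upper) simp
  define \<beta> where "\<beta> = x \<bullet> y - b"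
  let ?E = "{(x, r::real). h x \<le> ereal r}"
  have "h x \<le> ereal \<beta>"
  proof (rule ccontr)
    assume "\<not> h x \<le> ereal \<beta>"
    then have notin: "(x, \<beta>) \<notin> ?E" by simp
    have "convex ?E" "closed ?E"
      using assms closed_epigraph by (auto simp: econvex_def)
    then obtain n c where "n \<bullet> (x, \<beta>) < c" "\<forall>e\<in>?E. c < n \<bullet> e"
      using separating_hyperplane_closed_point[OF _ _ notin] by blast
    moreover obtain p s where "n = (p, s)" by (cases n)
    ultimately have sep: "p \<bullet> x + s * \<beta> < c"
      and above: "\<And>w r. h w \<le> ereal r \<Longrightarrow> c < p \<bullet> w + s * r"
      by auto
    obtain w0 r0 where w0: "h w0 = ereal r0"
      using assms(1) by (auto simp: proper_def edom_def) (metis ereal_cases less_irrefl)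
    have "0 \<le> s"
    proof (rule ccontr)
      assume "\<not> 0 \<le> s"
      then have s: "s < 0" by simp
      \<comment> \<open>High enough on the vertical line over \<open>w0\<close>, a negative \<open>s\<close> puts the epigraph on the wrong side.\<close>
      define r where "r = max r0 ((c - p \<bullet> w0) / s)"
      have "c < p \<bullet> w0 + s * r"
        by (rule above) (simp add: w0 r_def)
      moreover have "(c - p \<bullet> w0) / s \<le> r" by (simp add: r_def)
      then have "s * r \<le> c - p \<bullet> w0"
        using s by (simp add: divide_le_eq mult.commute)
      ultimately show False by simp
    qed
    then consider "s = 0" | "0 < s" by linarith
    then show False
    proof cases
      case 1
      have "conjugate h (y - p) \<le> ereal (b - c)"
        unfolding conjugate_def
      proof (rule SUP_least)
        fix w
        show "ereal ((y - p) \<bullet> w) - h w \<le> ereal (b - c)"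
        proof (cases w rule: proper_cases[OF assms(1)])
          case (2 r)
          then show ?thesis
            using above[of w r] upp[of w] 1 by (simp add: inner_diff_left)
        qed simp
      qed
      with low[of "y - p"] have "ereal (b + x \<bullet> (y - p - y)) \<le> ereal (b - c)"
        by (rule order_trans)
      then show False
        using sep 1 by (simp add: inner_commute)
    next
      case 2
      define z where "z = - (p /\<^sub>R s)"
      have z: "z \<bullet> w = - (p \<bullet> w) / s" for w
        by (simp add: z_def divide_inverse mult.commute)
      have "conjugate h z \<le> ereal (- c / s)"
        unfolding conjugate_def
      proof (rule SUP_least)
        fix w
        show "ereal (z \<bullet> w) - h w \<le> ereal (- c / s)"
        proof (cases w rule: proper_cases[OF assms(1)])
          case (2 r)
          have "c / s \<le> (p \<bullet> w + s * r) / s"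
            using above[of w r] 2 \<open>0 < s\<close> by (intro divide_right_mono) auto
          also have "\<dots> = p \<bullet> w / s + r"
            using \<open>0 < s\<close> by (simp add: add_divide_distrib)
          finally show ?thesis
            by (simp add: z 2)
        qed simp
      qed
      with low[of z] have "ereal (b + x \<bullet> (z - y)) \<le> ereal (- c / s)"
        by (rule order_trans)
      then have "z \<bullet> x - \<beta> \<le> - c / s"
        by (simp add: \<beta>_def inner_diff_right inner_commute)
      then have "c / s \<le> p \<bullet> x / s + \<beta>"
        by (simp add: z)
      also have "\<dots> = (p \<bullet> x + s * \<beta>) / s"
        using 2 by (simp add: add_divide_distrib)
      also have "\<dots> < c / s"
        using sep 2 by (rule divide_strict_right_mono)
      finally show False by simp
    qed
  qed
  then obtain a where a: "h x = ereal a" "a \<le> \<beta>"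
    using assms(1) by (cases "h x") (auto simp: proper_def)
  have "h x + ereal (y \<bullet> (z - x)) \<le> h z" for z
  proof (cases z rule: proper_cases[OF assms(1)])
    case (2 r)
    then show ?thesis
      using upp[of z] a by (simp add: \<beta>_def inner_diff_right inner_commute)
  qed simp
  then show ?thesis
    by (simp add: subdifferential_def a)
qed

section \<open>Gradients along segments\<close>

lemma GDERIV_gradient:
  fixes F :: "'a::euclidean_space \<Rightarrow> real"
  assumes "F differentiable (at x)"
  shows "GDERIV F x :> gradient F x"
proof -
  obtain F' where F': "(F has_derivative F') (at x)"
    using assms by (auto simp: differentiable_def)
  then have "linear F'" by (rule has_derivative_linear)
  \<comment> \<open>The vector that represents the functional \<open>F'\<close> is the image of \<open>1\<close> under its adjoint.\<close>
  then have "F' = (\<lambda>v. v \<bullet> adjoint F' 1)"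
    by (simp add: adjoint_works fun_eq_iff)
  with F' have D: "GDERIV F x :> adjoint F' 1"
    by (simp add: gderiv_def)
  moreover have "d = adjoint F' 1" if "GDERIV F x :> d" for d
  proof -
    have "(\<lambda>v. v \<bullet> d) = (\<lambda>v. v \<bullet> adjoint F' 1)"
      using has_derivative_unique that D unfolding gderiv_def by blast
    then show ?thesis by (metis vector_eq_ldot)
  qed
  ultimately show ?thesis
    unfolding gradient_def by (rule theI)
qed

lemma eventually_segment_in_interior:
  fixes p w :: "'a::real_normed_vector"
  assumes "p \<in> interior S"
  shows "\<forall>\<^sub>F t in at_right (0::real). p + t *\<^sub>R w \<in> interior S"
proof -
  have "((\<lambda>t. p + t *\<^sub>R w) \<longlongrightarrow> p + 0 *\<^sub>R w) (at_right 0)"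
    by (intro tendsto_intros)
  then show ?thesis
    using topological_tendstoD[of _ p _ "interior S"] assms by simp
qed

lemma GDERIV_upper_slope:
  assumes F: "GDERIV F p :> D"
    and le: "\<forall>\<^sub>F t in at_right 0. F (p + t *\<^sub>R w) \<le> F p + t * c"
  shows "D \<bullet> w \<le> c"
proof (rule ccontr)
  assume "\<not> D \<bullet> w \<le> c"
  have "((\<lambda>t. p + t *\<^sub>R w) has_derivative (\<lambda>t. t *\<^sub>R w)) (at (0::real))"
    by (auto intro!: derivative_eq_intros)
  moreover have "(F has_derivative (\<lambda>v. v \<bullet> D)) (at (p + 0 *\<^sub>R w))"
    using F by (simp add: gderiv_def)
  ultimately have "((\<lambda>t. F (p + t *\<^sub>R w)) has_derivative (\<lambda>t. (t *\<^sub>R w) \<bullet> D)) (at (0::real))"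
    by (rule has_derivative_compose)
  then have "((\<lambda>t. F (p + t *\<^sub>R w)) has_real_derivative (D \<bullet> w)) (at 0)"
    by (simp add: has_field_derivative_def inner_commute mult_commute_abs)
  then have "((\<lambda>t. F (p + t *\<^sub>R w) - t * c) has_real_derivative (D \<bullet> w - c)) (at 0)"
    by (auto intro!: derivative_eq_intros)
  from DERIV_pos_inc_right[OF this] obtain d
    where "d > 0" and inc: "\<And>t. 0 < t \<Longrightarrow> t < d \<Longrightarrow> F p < F (p + t *\<^sub>R w) - t * c"
    using \<open>\<not> D \<bullet> w \<le> c\<close> by auto
  from \<open>d > 0\<close> inc have "\<forall>\<^sub>F t in at_right 0. F p < F (p + t *\<^sub>R w) - t * c"
    unfolding eventually_at_right_field by blast
  with le have "\<forall>\<^sub>F t in at_right (0::real). False"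
    by eventually_elim simp
  then show False by simp
qed

lemma GDERIV_lower_slope:
  assumes F: "GDERIV F p :> D"
    and ge: "\<forall>\<^sub>F t in at_right 0. F p + t * c \<le> F (p + t *\<^sub>R w)"
  shows "c \<le> D \<bullet> w"
proof -
  have "(- D) \<bullet> w \<le> - c"
    by (rule GDERIV_upper_slope[OF GDERIV_minus[OF F]]) (use ge in \<open>eventually_elim, simp\<close>)
  then show ?thesis by simp
qed

lemma econvex_gradient_inequality:
  assumes "proper f" and "econvex f" and "u \<in> interior (edom f)"
    and D: "GDERIV (\<lambda>y. real_of_ereal (f y)) u :> D"
    and v: "f v = ereal b"
  shows "real_of_ereal (f u) + D \<bullet> (v - u) \<le> b"
proof -
  have "u \<in> edom f" using assms(3) interior_subset by blast
  note fu = ereal_real_of_edom[OF assms(1) this]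
  have "\<forall>\<^sub>F t in at_right (0::real). 0 < t \<and> t < 1"
    unfolding eventually_at_right_field by (intro exI[of _ 1]) auto
  then have "\<forall>\<^sub>F t in at_right 0.
      real_of_ereal (f (u + t *\<^sub>R (v - u))) \<le> real_of_ereal (f u) + t * (b - real_of_ereal (f u))"
  proof eventually_elim
    case (elim t)
    then have "f (u + t *\<^sub>R (v - u)) \<le> ereal (real_of_ereal (f u) + t * (b - real_of_ereal (f u)))"
      by (intro econvex_segment[OF assms(2) fu v]) auto
    then show ?case
      by (cases "u + t *\<^sub>R (v - u)" rule: proper_cases[OF assms(1)]) auto
  qed
  from GDERIV_upper_slope[OF D this] show ?thesis by simp
qed

text \<open>
  The derivative of \<open>t \<mapsto> \<langle>\<nabla>F(u + t(v - u)), v - u\<rangle>\<close> at \<open>0\<close> is positive, so this directional slope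
  is strictly larger at a nearby point \<open>p\<close> of the segment than at \<open>u\<close>.  Strictness follows by
  chaining the gradient inequalities from \<open>u\<close> to \<open>p\<close> and from \<open>p\<close> to \<open>v\<close>.  The endpoint \<open>v\<close> may
  lie on the boundary of the domain, since gradients are taken only at \<open>u\<close> and \<open>p\<close>.
\<close>

lemma strict_gradient_inequality:
  fixes f :: "'a::euclidean_space \<Rightarrow> ereal"
  defines "F \<equiv> \<lambda>y. real_of_ereal (f y)"
  assumes f: "proper f" "econvex f" and u: "u \<in> interior (edom f)"
    and diff: "\<And>y. y \<in> interior (edom f) \<Longrightarrow> F differentiable (at y)"
    and diff2: "gradient F differentiable (at u)"
    and pd: "positive_definite (hessian F u)"
    and v: "f v = ereal b" and "v \<noteq> u"
  shows "F u + gradient F u \<bullet> (v - u) < b"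
proof -
  define w where "w = v - u"
  define q where "q t = gradient F (u + t *\<^sub>R w) \<bullet> w" for t
  have grad: "(gradient F has_derivative hessian F u) (at u)"
    using diff2 by (simp add: hessian_def frechet_derivative_works[symmetric])
  have "((\<lambda>t. u + t *\<^sub>R w) has_derivative (\<lambda>t. t *\<^sub>R w)) (at (0::real))"
    by (auto intro!: derivative_eq_intros)
  then have "((\<lambda>t. gradient F (u + t *\<^sub>R w)) has_derivative (\<lambda>t. hessian F u (t *\<^sub>R w))) (at (0::real))"
    using has_derivative_compose[of "\<lambda>t. u + t *\<^sub>R w" _ 0 UNIV "gradient F"] grad by simp
  then have "(q has_derivative (\<lambda>t. hessian F u (t *\<^sub>R w) \<bullet> w)) (at 0)"
    unfolding q_def by (auto intro!: derivative_eq_intros)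
  moreover have "hessian F u (t *\<^sub>R w) \<bullet> w = (w \<bullet> hessian F u w) * t" for t
    using linear_scale[OF has_derivative_linear[OF grad], of t w]
    by (simp add: inner_commute)
  ultimately have "(q has_real_derivative (w \<bullet> hessian F u w)) (at 0)"
    by (simp add: has_field_derivative_def)
  moreover have "0 < w \<bullet> hessian F u w"
    using pd \<open>v \<noteq> u\<close> by (simp add: positive_definite_def w_def)
  ultimately obtain d where "d > 0" and inc: "\<And>t. 0 < t \<Longrightarrow> t < d \<Longrightarrow> q 0 < q t"
    using DERIV_pos_inc_right[of q "w \<bullet> hessian F u w" 0] by auto
  from \<open>d > 0\<close> have "\<forall>\<^sub>F t in at_right 0. t < d \<and> t < 1 \<and> 0 < t"
    unfolding eventually_at_right_field by (intro exI[of _ "min d 1"]) auto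
  then have "\<forall>\<^sub>F t in at_right 0. (t < d \<and> t < 1 \<and> 0 < t) \<and> u + t *\<^sub>R w \<in> interior (edom f)"
    using eventually_segment_in_interior[OF u] by (rule eventually_conj)
  then obtain t where t: "t < d" "t < 1" "0 < t" and p: "u + t *\<^sub>R w \<in> interior (edom f)"
    using eventually_happens[of _ "at_right (0::real)"] by auto
  have "f (u + t *\<^sub>R w) = ereal (F (u + t *\<^sub>R w))"
    unfolding F_def using ereal_real_of_edom[OF f(1)] p interior_subset by blast
  then have "F u + gradient F u \<bullet> (u + t *\<^sub>R w - u) \<le> F (u + t *\<^sub>R w)"
    using econvex_gradient_inequality[OF f u] GDERIV_gradient[OF diff[OF u]]
    unfolding F_def by blast
  then have 1: "F u + t * q 0 \<le> F (u + t *\<^sub>R w)"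
    by (simp add: q_def)
  have "F (u + t *\<^sub>R w) + gradient F (u + t *\<^sub>R w) \<bullet> (v - (u + t *\<^sub>R w)) \<le> b"
    using econvex_gradient_inequality[OF f p] GDERIV_gradient[OF diff[OF p]] v
    unfolding F_def by blast
  moreover have "v - (u + t *\<^sub>R w) = (1 - t) *\<^sub>R w"
    by (simp add: w_def algebra_simps)
  ultimately have 2: "F (u + t *\<^sub>R w) + (1 - t) * q t \<le> b"
    by (simp add: q_def)
  have "(1 - t) * q 0 < (1 - t) * q t"
    using inc t by simp
  with 1 2 have "F u + q 0 < b"
    by (simp add: algebra_simps)
  then show ?thesis by (simp add: q_def w_def)
qed

section \<open>Minimizers of the composite problem\<close>

lemma is_arg_min_iff_le:
  fixes h :: "'a \<Rightarrow> 'b::linorder"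
  shows "is_arg_min h (\<lambda>_. True) x \<longleftrightarrow> (\<forall>z. h x \<le> h z)"
  by (auto simp: is_arg_min_def not_less)

text \<open>
  Optimality along the segment from \<open>x\<close> to \<open>z\<close>, together with convexity of \<open>g\<close>, bounds the
  difference quotients of \<open>F\<close> in direction \<open>\<Phi>(z - x)\<close> from below by \<open>g(x) - g(z)\<close>.
\<close>

lemma first_order_optimality:
  fixes \<Phi> :: "'a::euclidean_space \<Rightarrow> 'b::euclidean_space"
  assumes "linear \<Phi>" and "proper f" and g: "proper g" "econvex g"
    and x: "\<Phi> x \<in> interior (edom f)" "x \<in> edom g"
    and D: "GDERIV (\<lambda>y. real_of_ereal (f y)) (\<Phi> x) :> D"
    and opt: "\<And>z. f (\<Phi> x) + g x \<le> f (\<Phi> z) + g z"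
  shows "- adjoint \<Phi> D \<in> subdifferential g x"
proof -
  define F where "F = (\<lambda>y. real_of_ereal (f y))"
  have fF: "f y = ereal (F y)" if "y \<in> interior (edom f)" for y
    unfolding F_def using ereal_real_of_edom[OF assms(2)] that interior_subset by blast
  obtain a where a: "g x = ereal a"
    using ereal_real_of_edom[OF g(1) x(2)] by blast
  have "g x + ereal (- adjoint \<Phi> D \<bullet> (z - x)) \<le> g z" for z
  proof (cases z rule: proper_cases[OF g(1)])
    case (2 b)
    have "\<forall>\<^sub>F t in at_right (0::real). 0 < t \<and> t < 1"
      unfolding eventually_at_right_field by (intro exI[of _ 1]) auto
    then have "\<forall>\<^sub>F t in at_right 0. F (\<Phi> x) + t * (a - b) \<le> F (\<Phi> x + t *\<^sub>R \<Phi> (z - x))"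
      using eventually_segment_in_interior[OF x(1), of "\<Phi> (z - x)"]
    proof eventually_elim
      case (elim t)
      have \<Phi>: "\<Phi> (x + t *\<^sub>R (z - x)) = \<Phi> x + t *\<^sub>R \<Phi> (z - x)"
        using assms(1) by (simp add: linear_add linear_scale)
      have "g (x + t *\<^sub>R (z - x)) \<le> ereal (a + t * (b - a))"
        using econvex_segment[OF g(2) a 2] elim by simp
      then have "f (\<Phi> x) + g x \<le> f (\<Phi> x + t *\<^sub>R \<Phi> (z - x)) + ereal (a + t * (b - a))"
        using opt[of "x + t *\<^sub>R (z - x)"] unfolding \<Phi> by (meson add_left_mono order_trans)
      then show ?case
        using elim by (simp add: fF x(1) a algebra_simps)
    qed
    then have "a - b \<le> D \<bullet> \<Phi> (z - x)"
      using GDERIV_lower_slope D unfolding F_def by blast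
    moreover have "adjoint \<Phi> D \<bullet> (z - x) = D \<bullet> \<Phi> (z - x)"
      using adjoint_works[OF assms(1), of "z - x" D] by (simp add: inner_commute)
    ultimately show ?thesis
      by (simp add: a 2)
  qed simp
  then show ?thesis by (simp add: subdifferential_def a)
qed

theorem theorem3p1:
  fixes \<Phi> :: "'a::euclidean_space \<Rightarrow> 'b::euclidean_space"
    and f :: "'b \<Rightarrow> ereal" and g :: "'a \<Rightarrow> ereal"
    and xbar ybar :: 'a
  assumes "linear \<Phi>"
    and "proper f" and "lsc f" and "econvex f"
    and "C2_on (\<lambda>y. real_of_ereal (f y)) (interior (edom f))"
    and "\<forall>y \<in> interior (edom f). positive_definite (hessian (\<lambda>y. real_of_ereal (f y)) y)"
    and "proper g" and "lsc g" and "econvex g"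
    and "xbar \<in> \<Phi> -` interior (edom f) \<inter> edom g"
    and "xbar \<in> optimal_solutions (\<lambda>x. f (\<Phi> x) + g x)"
    and "ybar = - adjoint \<Phi> (gradient (\<lambda>y. real_of_ereal (f y)) (\<Phi> xbar))"
  shows "ybar \<in> subdifferential g xbar \<and>
    (optimal_solutions (\<lambda>x. f (\<Phi> x) + g x) = {xbar} \<longleftrightarrow>
     {x. \<Phi> x = 0} \<inter> radial_cone (subdifferential (conjugate g) ybar) xbar = {0})"
proof -
  define F where "F = (\<lambda>y. real_of_ereal (f y))"
  define Opt where "Opt = optimal_solutions (\<lambda>x. f (\<Phi> x) + g x)"
  have Opt_iff: "x \<in> Opt \<longleftrightarrow> (\<forall>z. f (\<Phi> x) + g x \<le> f (\<Phi> z) + g z)" for x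
    by (simp add: Opt_def optimal_solutions_def is_arg_min_iff_le)
  have xbar_Opt: "xbar \<in> Opt"
    using assms by (simp add: Opt_def)
  have ubar: "\<Phi> xbar \<in> interior (edom f)" and "xbar \<in> edom g"
    using assms by auto
  have diff: "F differentiable (at y)" "gradient F differentiable (at y)"
    if "y \<in> interior (edom f)" for y
    using assms(5) that by (auto simp: C2_on_def F_def)
  have D: "GDERIV (\<lambda>y. real_of_ereal (f y)) (\<Phi> xbar) :> gradient F (\<Phi> xbar)"
    using GDERIV_gradient[OF diff(1)[OF ubar]] by (simp add: F_def)
  have ybar: "ybar = - adjoint \<Phi> (gradient F (\<Phi> xbar))"
    using assms by (simp add: F_def)
  have ybar_inner: "ybar \<bullet> w = - (gradient F (\<Phi> xbar) \<bullet> \<Phi> w)" for w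
    using adjoint_works[OF assms(1), of w] by (simp add: ybar inner_commute)
  have fbar: "f (\<Phi> xbar) = ereal (F (\<Phi> xbar))"
    unfolding F_def using ereal_real_of_edom[OF assms(2)] ubar interior_subset by blast
  obtain a where a: "g xbar = ereal a"
    using ereal_real_of_edom[OF assms(7) \<open>xbar \<in> edom g\<close>] by blast

  have stationary: "ybar \<in> subdifferential g x"
    if "x \<in> Opt" "\<Phi> x = \<Phi> xbar" "x \<in> edom g" for x
    unfolding ybar
    using first_order_optimality[OF assms(1,2,7,9), of x] that ubar D Opt_iff by simp
  have ybar_sub: "ybar \<in> subdifferential g xbar"
    by (rule stationary) (use xbar_Opt \<open>xbar \<in> edom g\<close> in auto)

  have Opt_char: "Opt = {x. \<Phi> (x - xbar) = 0 \<and> x \<in> subdifferential (conjugate g) ybar}"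
  proof (intro set_eqI iffI)
    fix x assume x: "x \<in> Opt"
    then have le: "f (\<Phi> x) + g x \<le> ereal (F (\<Phi> xbar) + a)"
      using Opt_iff[of x] fbar a by (metis plus_ereal.simps(1))
    then obtain b where b: "f (\<Phi> x) = ereal b"
      by (cases "\<Phi> x" rule: proper_cases[OF assms(2)];
          cases x rule: proper_cases[OF assms(7)]) auto
    with le obtain r where r: "g x = ereal r"
      by (cases x rule: proper_cases[OF assms(7)]) auto
    have "\<Phi> x = \<Phi> xbar"
    proof (rule ccontr)
      assume ne: "\<Phi> x \<noteq> \<Phi> xbar"
      have "F (\<Phi> xbar) + gradient F (\<Phi> xbar) \<bullet> (\<Phi> x - \<Phi> xbar) < b"
        unfolding F_def
        by (rule strict_gradient_inequality[OF assms(2,4) ubar _ _ _ b ne])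
          (use diff ubar assms(6) in \<open>auto simp: F_def\<close>)
      moreover have "g xbar + ereal (ybar \<bullet> (x - xbar)) \<le> g x"
        using ybar_sub by (simp add: subdifferential_def)
      then have "a - gradient F (\<Phi> xbar) \<bullet> (\<Phi> x - \<Phi> xbar) \<le> r"
        using assms(1) by (simp add: a r ybar_inner linear_diff)
      ultimately show False
        using le by (simp add: b r)
    qed
    moreover from this x r have "ybar \<in> subdifferential g x"
      by (intro stationary) (auto simp: edom_def)
    ultimately show "x \<in> {x. \<Phi> (x - xbar) = 0 \<and> x \<in> subdifferential (conjugate g) ybar}"
      using assms(1) by (simp add: linear_diff subdifferential_imp_conjugate)
  next
    fix x assume "x \<in> {x. \<Phi> (x - xbar) = 0 \<and> x \<in> subdifferential (conjugate g) ybar}"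
    then have \<Phi>: "\<Phi> x = \<Phi> xbar" and sub: "ybar \<in> subdifferential g x"
      using assms(1) conjugate_subdifferential_imp[OF assms(7,8,9)] by (auto simp: linear_diff)
    have "ybar \<bullet> (xbar - x) = 0"
      using assms(1) by (simp add: ybar_inner linear_diff \<Phi>)
    moreover have "g x + ereal (ybar \<bullet> (xbar - x)) \<le> g xbar"
      using sub by (simp add: subdifferential_def)
    ultimately have "g x \<le> g xbar" by (simp add: zero_ereal_def[symmetric])
    then have "f (\<Phi> x) + g x \<le> f (\<Phi> xbar) + g xbar"
      by (simp add: \<Phi> add_left_mono)
    then show "x \<in> Opt"
      using xbar_Opt unfolding Opt_iff by (meson order_trans)
  qed

  have "Opt = {xbar} \<longleftrightarrow>
     {x. \<Phi> x = 0} \<inter> radial_cone (subdifferential (conjugate g) ybar) xbar = {0}"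
  proof
    assume uniq: "Opt = {xbar}"
    have "v = 0" if "\<Phi> v = 0" and v: "v \<in> radial_cone (subdifferential (conjugate g) ybar) xbar" for v
    proof -
      obtain t w where tw: "v = t *\<^sub>R (w - xbar)" "w \<in> subdifferential (conjugate g) ybar"
        using v by (auto simp: radial_cone_def)
      show ?thesis
      proof (cases "t = 0")
        case False
        then have "\<Phi> (w - xbar) = 0"
          using \<open>\<Phi> v = 0\<close> assms(1) by (simp add: tw linear_scale)
        then have "w \<in> Opt" using tw by (simp add: Opt_char)
        then show ?thesis using uniq tw by simp
      qed (simp add: tw)
    qed
    moreover have "0 \<in> radial_cone (subdifferential (conjugate g) ybar) xbar"
      using subdifferential_imp_conjugate[OF ybar_sub]
      by (auto simp: radial_cone_def)
    ultimately show "{x. \<Phi> x = 0} \<inter> radial_cone (subdifferential (conjugate g) ybar) xbar = {0}"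
      using linear_0[OF assms(1)] by auto
  next
    assume triv: "{x. \<Phi> x = 0} \<inter> radial_cone (subdifferential (conjugate g) ybar) xbar = {0}"
    have "x = xbar" if "x \<in> Opt" for x
    proof -
      have ker: "\<Phi> (x - xbar) = 0" and sub: "x \<in> subdifferential (conjugate g) ybar"
        using that by (auto simp: Opt_char)
      have "x - xbar = 1 *\<^sub>R (x - xbar)" by simp
      then have "x - xbar \<in> radial_cone (subdifferential (conjugate g) ybar) xbar"
        using sub zero_le_one unfolding radial_cone_def by blast
      with ker have "x - xbar \<in> {0}"
        unfolding triv[symmetric] by (intro IntI CollectI)
      then show ?thesis by simp
    qed
    then show "Opt = {xbar}" using xbar_Opt by blast
  qed
  with ybar_sub show ?thesis by (simp add: Opt_def)
qed

end
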